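(* Let $X$ be a continuous vector field on $\mathbb{S}^1$, and let $\lambda$ be the infinitesimal earthquake measure of a left (or right) infinitesimal earthquake extending continuously to $X$, i.e. $\lambda=\lambda^-$ (resp. $\lambda=\lambda^+$) as defined below. Then $$\frac{1-\tanh(1)}{2\sqrt2}\,\lVert\lambda\rVert_{\mathrm{Th}}\le w(X)\le\frac83\lVert X\rVert_{cr}.$$
   Context: Notation: $\mathbb{R}^{1,2}$ is $\mathbb{R}^3$ with $\langle x,y\rangle=-x_0y_0+x_1y_1+x_2y_2$; $\mathbb{H}^2$ is identified with the Klein disk $\mathbb{D}^2$ via $\Pi(x_0,x_1,x_2)=(x_1/x_0,x_2/x_0)$, with ideal boundary $\mathbb{S}^1$. A vector field $X$ on $\mathbb{S}^1$ is written $X(z)=iz\,\phi_X(z)$ with $\phi_X:\mathbb{S}^1\to\mathbb{R}$ its support function. For $\phi:\mathbb{S}^1\to\mathbb{R}$ and $\eta\in\overline{\mathbb{D}^2}$ set $\phi^-(\eta)=\sup\{a(\eta): a:\mathbb{R}^2\to\mathbb{R}\text{ affine}, a|_{\mathbb{S}^1}\le\phi\}$ and $\phi^+(\eta)=\inf\{a(\eta): a\text{ affine}, a|_{\mathbb{S}^1}\ge\phi\}$. Width: $w(X)=\sup_{\eta\in\mathbb{D}^2}\frac{\phi_X^+(\eta)-\phi_X^-(\eta)}{\sqrt{1-|\eta|^2}}\in[0,+\infty]$. For $\sigma\in\mathbb{R}^{1,2}$ let $P_\sigma=\{(\eta,t)\in\mathbb{D}^2\times\mathbb{R}: t=\langle(1,\eta),\sigma\rangle\}$.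 Let $\Sigma^-(\eta)$ be the set of $\sigma$ with $\langle(1,\xi),\sigma\rangle\le\phi_X^-(\xi)$ for all $\xi\in\mathbb{D}^2$ and equality at $\xi=\eta$ (support planes of the graph of $\phi_X^-$ at $\eta$), and $\Sigma^+(\eta)$ likewise with $\ge\phi_X^+$. For $\sigma$ with $P_\sigma$ a support plane of the graph of $\phi_X^\pm$ at some point, let $S^\pm(\sigma)=\{\eta\in\mathbb{D}^2:\phi_X^\pm(\eta)=\langle(1,\eta),\sigma\rangle\}$; the geodesic lamination $\lambda^\pm$ consists of the connected components of $S^\pm(\sigma)\setminus\mathrm{Int}\,S^\pm(\sigma)$ over all such $\sigma$. Its (bending) measure: for an arc $c:[0,1]\to\mathbb{D}^2$, $\lambda^\pm(c)=\inf\sum_{i=0}^{n-1}\sqrt{\langle\sigma_i-\sigma_{i+1},\sigma_i-\sigma_{i+1}\rangle}$ over all $0=t_0<\dots<t_n=1$ and $\sigma_i\in\Sigma^\pm(c(t_i))$. The infinitesimal earthquake measure of a left (resp. right) infinitesimal earthquake extending continuously to $X$ is $\lambda^-$ (resp. $\lambda^+$). The Thurston norm is $\lVert\lambda\rVert_{\mathrm{Th}}=\sup_I\lambda(I)$ over geodesic segments $I$ of hyperbolic length $1$ transverse to the support of $\lambda$. Cross-ratio norm: identify $\mathbb{S}^1$ with $\mathbb{RP}^1=\mathbb{R}\cup\{\infty\}$ by a projective (Möbius) identification and write $X$ as $X(x)\partial_x$. For $Q=[a,b,c,d]$ set $\mathrm{cr}(Q)=\frac{(b-a)(d-c)}{(c-b)(d-a)}$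 and $X[Q]=\frac{X(b)-X(a)}{b-a}-\frac{X(c)-X(b)}{c-b}+\frac{X(d)-X(c)}{d-c}-\frac{X(a)-X(d)}{a-d}$; then $\lVert X\rVert_{cr}=\sup_{\mathrm{cr}(Q)=1}|X[Q]|\in[0,+\infty]$. Infinitesimal earthquakes: a left (resp. right) infinitesimal earthquake along a geodesic lamination is a vector field on $\mathbb{H}^2$ equal to a Killing field on each stratum, such that the difference of the Killing fields of any two strata $S,S'$ is zero only if one is in the closure of the other, and otherwise is a hyperbolic Killing field whose axis weakly separates $S,S'$ and which translates to the left (resp. right) seen from $S$ to $S'$; it extends continuously to $X$ if $\mathcal{E}(\eta_n)\to X(z)$ whenever $\eta_n\to z\in\mathbb{S}^1$. *)

theory Defs
  imports "HOL-Analysis.Analysis"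
begin

text \<open>Points of R^2 are complex numbers; S^1 = sphere 0 1, Klein disk D^2 = ball 0 1.
  A vector field X(z) = i z phi(z) on S^1 is represented by its support function phi.\<close>

type_synonym mvec = "real \<times> real \<times> real"

definition affine_fun :: "(complex \<Rightarrow> real) \<Rightarrow> bool" where
  "affine_fun a \<longleftrightarrow> (\<exists>c0 c1 c2. \<forall>z. a z = c0 + c1 * Re z + c2 * Im z)"

definition phi_lower :: "(complex \<Rightarrow> real) \<Rightarrow> complex \<Rightarrow> real" where
  "phi_lower phi \<eta> = Sup {a \<eta> | a. affine_fun a \<and> (\<forall>z\<in>sphere 0 1. a z \<le> phi z)}"

definition phi_upper :: "(complex \<Rightarrow> real) \<Rightarrow> complex \<Rightarrow> real" where
  "phi_upper phi \<eta> = Inf {a \<eta> | a. affine_fun a \<and> (\<forall>z\<in>sphere 0 1. phi z \<le> a z)}"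

definition width :: "(complex \<Rightarrow> real) \<Rightarrow> ereal" where
  "width phi = Sup {ereal ((phi_upper phi \<eta> - phi_lower phi \<eta>) / sqrt (1 - (cmod \<eta>)\<^sup>2)) | \<eta>. \<eta> \<in> ball 0 1}"

text \<open>Minkowski pairing <(1,eta), sigma> in R^{1,2}, and <s - t, s - t>.\<close>
definition mpair :: "complex \<Rightarrow> mvec \<Rightarrow> real" where
  "mpair \<eta> \<sigma> = - fst \<sigma> + Re \<eta> * fst (snd \<sigma>) + Im \<eta> * snd (snd \<sigma>)"

definition msq :: "mvec \<Rightarrow> mvec \<Rightarrow> real" where
  "msq \<sigma> \<tau> = - (fst \<sigma> - fst \<tau>)\<^sup>2 + (fst (snd \<sigma>) - fst (snd \<tau>))\<^sup>2
              + (snd (snd \<sigma>) - snd (snd \<tau>))\<^sup>2"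

definition Sigma_lower :: "(complex \<Rightarrow> real) \<Rightarrow> complex \<Rightarrow> mvec set" where
  "Sigma_lower phi \<eta> = {\<sigma>. (\<forall>\<xi>\<in>ball 0 1. mpair \<xi> \<sigma> \<le> phi_lower phi \<xi>)
                              \<and> mpair \<eta> \<sigma> = phi_lower phi \<eta>}"

definition Sigma_upper :: "(complex \<Rightarrow> real) \<Rightarrow> complex \<Rightarrow> mvec set" where
  "Sigma_upper phi \<eta> = {\<sigma>. (\<forall>\<xi>\<in>ball 0 1. mpair \<xi> \<sigma> \<ge> phi_upper phi \<xi>)
                              \<and> mpair \<eta> \<sigma> = phi_upper phi \<eta>}"

definition contact :: "(complex \<Rightarrow> real) \<Rightarrow> mvec \<Rightarrow> complex set" where
  "contact h \<sigma> = {\<eta> \<in> ball 0 1. h \<eta> = mpair \<eta> \<sigma>}"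

definition leaves :: "(complex \<Rightarrow> mvec set) \<Rightarrow> (complex \<Rightarrow> real) \<Rightarrow> complex set set" where
  "leaves Sig h = {connected_component_set (contact h \<sigma> - interior (contact h \<sigma>)) x | \<sigma> x.
      (\<exists>\<eta>\<in>ball 0 1. \<sigma> \<in> Sig \<eta>) \<and> x \<in> contact h \<sigma> - interior (contact h \<sigma>)}"

definition bend :: "(complex \<Rightarrow> mvec set) \<Rightarrow> (real \<Rightarrow> complex) \<Rightarrow> ereal" where
  "bend Sig c = Inf {ereal (\<Sum>i<n. sqrt (msq (\<sigma> i) (\<sigma> (Suc i)))) | n t \<sigma>.
      t 0 = 0 \<and> t n = 1 \<and> (\<forall>i<n. t i < t (Suc i)) \<and> (\<forall>i\<le>n. \<sigma> i \<in> Sig (c (t i)))}"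

definition klein_dist :: "complex \<Rightarrow> complex \<Rightarrow> real" where
  "klein_dist p q = arcosh ((1 - p \<bullet> q) / sqrt ((1 - (cmod p)\<^sup>2) * (1 - (cmod q)\<^sup>2)))"

definition thurston_norm :: "(complex \<Rightarrow> mvec set) \<Rightarrow> (complex \<Rightarrow> real) \<Rightarrow> ereal" where
  "thurston_norm Sig h = Sup {bend Sig (\<lambda>t. p + t *\<^sub>R (q - p)) | p q.
      p \<in> ball 0 1 \<and> q \<in> ball 0 1 \<and> klein_dist p q = 1 \<and>
      (\<forall>L\<in>leaves Sig h. \<forall>x y. x \<in> closed_segment p q \<inter> L \<and> y \<in> closed_segment p q \<inter> L \<longrightarrow> x = y)}"

text \<open>Cross-ratio norm. S^1 is identified with RP^1 by the Cayley map x |-> (x - i)/(x + i);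
  then X(z) = i z phi(z) becomes X(x) d/dx with X(x) = (x^2 + 1)/2 * phi((x - i)/(x + i)).\<close>
definition cayley :: "real \<Rightarrow> complex" where
  "cayley x = (complex_of_real x - \<i>) / (complex_of_real x + \<i>)"

definition Xline :: "(complex \<Rightarrow> real) \<Rightarrow> real \<Rightarrow> real" where
  "Xline phi x = (x\<^sup>2 + 1) / 2 * phi (cayley x)"

definition cross_ratio :: "real \<Rightarrow> real \<Rightarrow> real \<Rightarrow> real \<Rightarrow> real" where
  "cross_ratio a b c d = ((b - a) * (d - c)) / ((c - b) * (d - a))"

definition Xbracket :: "(real \<Rightarrow> real) \<Rightarrow> real \<Rightarrow> real \<Rightarrow> real \<Rightarrow> real \<Rightarrow> real" where
  "Xbracket X a b c d = (X b - X a) / (b - a) - (X c - X b) / (c - b)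
                       + (X d - X c) / (d - c) - (X a - X d) / (a - d)"

definition cr_norm :: "(complex \<Rightarrow> real) \<Rightarrow> ereal" where
  "cr_norm phi = Sup {ereal \<bar>Xbracket (Xline phi) a b c d\<bar> | a b c d. cross_ratio a b c d = 1}"

end

theory Submission
  imports Defs
begin

text \<open>
  Affine functions on the disk are the pairings with vectors of \<open>\<real>\<^sup>1\<^sup>,\<^sup>2\<close>, and
  \<open>\<phi>\<^sup>-(\<eta>)\<close> is attained by an affine minorant touching \<open>\<phi>\<close> in every closed half-plane through \<open>\<eta>\<close>.

  Lower bound: the bending of a segment \<open>pq\<close> is at most the Minkowski length \<open>m\<close> of \<open>\<sigma> - \<tau>\<close>
  for support planes \<open>\<sigma>\<close> at \<open>p\<close> and \<open>\<tau>\<close> at \<open>q\<close>. An affine majorant of \<open>\<phi>\<close> dominates both planes,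
  which keeps it at normalised height at least \<open>(m/2) (1 - sinh d)\<close> above \<open>\<phi>\<^sup>-\<close> at a point at
  distance \<open>d\<close> from the bending line; one of \<open>p\<close>, \<open>q\<close> has \<open>d \<le> 1/2\<close>.

  Upper bound: subtract the support plane at \<open>\<eta>\<close>, so that \<open>\<psi> = \<phi> - \<sigma> \<ge> 0\<close> vanishes at contact
  points \<open>z\<^sub>1\<close>, \<open>z\<^sub>2\<close>. Since affine functions do not change \<open>X[Q]\<close>, the harmonic quadruple
  \<open>z\<^sub>1, w, z\<^sub>2, w'\<close> gives \<open>\<psi>(w) |z\<^sub>1 - z\<^sub>2| \<le> \<parallel>X\<parallel> |w - z\<^sub>1| |w - z\<^sub>2|\<close>. Choosing \<open>z\<^sub>1\<close> in the half-plane
  of \<open>w\<close> and \<open>z\<^sub>2\<close> in the one opposite to \<open>z\<^sub>1\<close>, as seen from \<open>\<eta>\<close>, yields \<open>w(X) \<le> 2 \<parallel>X\<parallel>\<close>.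
\<close>

section \<open>Extremal affine minorants\<close>

text \<open>Encoding affine functions as vectors makes compactness in a three-dimensional space and
  Minkowski geometry available.\<close>

definition minorants :: "(complex \<Rightarrow> real) \<Rightarrow> mvec set" where
  "minorants \<phi> = {\<sigma>. \<forall>z\<in>sphere 0 1. mpair z \<sigma> \<le> \<phi> z}"

lemma mpair_add: "mpair z (\<sigma> + \<tau>) = mpair z \<sigma> + mpair z \<tau>"
  by (simp add: mpair_def algebra_simps)

lemma mpair_diff: "mpair z (\<sigma> - \<tau>) = mpair z \<sigma> - mpair z \<tau>"
  by (simp add: mpair_def algebra_simps)

lemma mpair_minus: "mpair z (- \<sigma>) = - mpair z \<sigma>"
  by (simp add: mpair_def algebra_simps)

lemma mpair_scaleR: "mpair z (c *\<^sub>R \<sigma>) = c * mpair z \<sigma>"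
  by (simp add: mpair_def algebra_simps)

lemmas mpair_linear = mpair_add mpair_diff mpair_minus mpair_scaleR

lemma affine_fun_iff_mpair: "affine_fun a \<longleftrightarrow> (\<exists>\<sigma>. a = (\<lambda>z. mpair z \<sigma>))"
proof
  assume "affine_fun a"
  then obtain c0 c1 c2 where "\<And>z. a z = c0 + c1 * Re z + c2 * Im z"
    unfolding affine_fun_def by blast
  then have "a = (\<lambda>z. mpair z (- c0, c1, c2))"
    by (simp add: mpair_def fun_eq_iff)
  then show "\<exists>\<sigma>. a = (\<lambda>z. mpair z \<sigma>)" ..
next
  assume "\<exists>\<sigma>. a = (\<lambda>z. mpair z \<sigma>)"
  then obtain \<sigma> where "a = (\<lambda>z. mpair z \<sigma>)" ..
  then have "\<forall>z. a z = - fst \<sigma> + fst (snd \<sigma>) * Re z + snd (snd \<sigma>) * Im z"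
    by (simp add: mpair_def)
  then show "affine_fun a"
    unfolding affine_fun_def by blast
qed

lemma phi_lower_eq_Sup: "phi_lower \<phi> \<eta> = Sup (mpair \<eta> ` minorants \<phi>)"
proof -
  have "{a \<eta> | a. affine_fun a \<and> (\<forall>z\<in>sphere 0 1. a z \<le> \<phi> z)} = mpair \<eta> ` minorants \<phi>"
    by (auto 4 4 simp: affine_fun_iff_mpair minorants_def simp del: split_paired_Ex)
  then show ?thesis by (simp only: phi_lower_def)
qed

text \<open>Negation exchanges majorants and minorants, so facts about the upper envelope follow
  from those about the lower one.\<close>

lemma phi_upper_eq: "phi_upper \<phi> \<eta> = - phi_lower (\<lambda>z. - \<phi> z) \<eta>"
proof -
  have "{a \<eta> | a. affine_fun a \<and> (\<forall>z\<in>sphere 0 1. \<phi> z \<le> a z)}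
      = uminus ` mpair \<eta> ` minorants (\<lambda>z. - \<phi> z)" (is "?A = ?B")
  proof
    show "?A \<subseteq> ?B"
    proof
      fix x assume "x \<in> ?A"
      then obtain \<sigma> where s: "x = mpair \<eta> \<sigma>" "\<forall>z\<in>sphere 0 1. \<phi> z \<le> mpair z \<sigma>"
        by (auto simp: affine_fun_iff_mpair)
      then have "x = - mpair \<eta> (- \<sigma>)" "- \<sigma> \<in> minorants (\<lambda>z. - \<phi> z)"
        by (auto simp: minorants_def mpair_minus)
      then show "x \<in> ?B" by blast
    qed
    show "?B \<subseteq> ?A"
    proof
      fix x assume "x \<in> ?B"
      then obtain \<sigma> where s: "x = - mpair \<eta> \<sigma>" "\<forall>z\<in>sphere 0 1. mpair z \<sigma> \<le> - \<phi> z"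
        by (auto simp: minorants_def)
      then have "x = mpair \<eta> (- \<sigma>)" "\<forall>z\<in>sphere 0 1. \<phi> z \<le> mpair z (- \<sigma>)"
        by (force simp: mpair_minus)+
      then show "x \<in> ?A"
        by (auto 4 4 simp: affine_fun_iff_mpair simp del: split_paired_Ex)
    qed
  qed
  then show ?thesis
    by (simp add: phi_upper_def phi_lower_eq_Sup Inf_real_def image_image)
qed

section \<open>Affine functions nonnegative on the circle as causal vectors\<close>

lemma mpair_ge: "- fst \<sigma> - norm (snd \<sigma>) * cmod \<eta> \<le> mpair \<eta> \<sigma>"
proof -
  have "- (norm (snd \<sigma>) * cmod \<eta>) \<le> snd \<sigma> \<bullet> (Re \<eta>, Im \<eta>)"
    using Cauchy_Schwarz_ineq2[of "snd \<sigma>" "(Re \<eta>, Im \<eta>)"]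
    by (simp add: norm_Pair cmod_def)
  also have "\<dots> = Re \<eta> * fst (snd \<sigma>) + Im \<eta> * snd (snd \<sigma>)"
    by (simp add: inner_prod_def)
  finally show ?thesis by (simp add: mpair_def)
qed

text \<open>On the circle the pairing is smallest in the direction opposite to the spatial part;
  evaluating there gives the bound.\<close>

lemma causal_if_nonneg:
  assumes "\<And>z. z \<in> sphere 0 1 \<Longrightarrow> 0 \<le> mpair z \<sigma>"
  shows "norm (snd \<sigma>) \<le> - fst \<sigma>"
proof (cases "snd \<sigma> = 0")
  case True
  then show ?thesis using assms[of 1] by (simp add: mpair_def)
next
  case False
  define r where "r = norm (snd \<sigma>)"
  have r: "r > 0" "r\<^sup>2 = (fst (snd \<sigma>))\<^sup>2 + (snd (snd \<sigma>))\<^sup>2"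
    using False by (simp add: r_def) (simp add: r_def norm_prod_def)
  define z where "z = Complex (- fst (snd \<sigma>) / r) (- snd (snd \<sigma>) / r)"
  have "(cmod z)\<^sup>2 = 1"
    using r(1) by (simp add: cmod_power2 z_def power_divide add_divide_distrib[symmetric] flip: r(2))
  then have "z \<in> sphere 0 1"
    by (simp add: power2_eq_1_iff) (smt (verit) norm_ge_zero)
  then have "0 \<le> mpair z \<sigma>" by (rule assms)
  also have "mpair z \<sigma> = - fst \<sigma> - r\<^sup>2 / r"
    unfolding r(2) by (simp add: mpair_def z_def power2_eq_square add_divide_distrib)
  finally show ?thesis using r(1) by (simp add: r_def power2_eq_square)
qed

lemma mpair_nonneg_cball:
  assumes "\<And>z. z \<in> sphere 0 1 \<Longrightarrow> 0 \<le> mpair z \<sigma>" and "\<eta> \<in> cball 0 1"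
  shows "0 \<le> mpair \<eta> \<sigma>"
proof -
  have "norm (snd \<sigma>) * cmod \<eta> \<le> norm (snd \<sigma>)"
    using assms(2) by (simp add: mult_left_le)
  then show ?thesis
    using mpair_ge[of \<sigma> \<eta>] causal_if_nonneg[OF assms(1)] by linarith
qed

lemma continuous_on_mpair: "continuous_on A (\<lambda>z. mpair z \<sigma>)"
  unfolding mpair_def by (intro continuous_intros)

lemma continuous_on_mpair_right: "continuous_on A (mpair z)"
  unfolding mpair_def by (intro continuous_intros)

text \<open>The minorants that are at least -M at \<open>\<eta>\<close> form a compact set, on which
  evaluation at \<open>\<eta>\<close> attains its maximum. All other minorants are lower at
  \<open>\<eta>\<close>.\<close>

lemma extremal_minorant_exists:
  assumes cont: "continuous_on (sphere 0 1) \<phi>" and \<eta>: "\<eta> \<in> ball 0 1"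
  obtains \<sigma> where "\<sigma> \<in> minorants \<phi>" "\<And>\<tau>. \<tau> \<in> minorants \<phi> \<Longrightarrow> mpair \<eta> \<tau> \<le> mpair \<eta> \<sigma>"
proof -
  have "bounded (\<phi> ` sphere 0 1)"
    by (intro compact_imp_bounded compact_continuous_image cont) simp
  then obtain M where M: "\<And>z. z \<in> sphere 0 1 \<Longrightarrow> \<bar>\<phi> z\<bar> \<le> M"
    unfolding bounded_iff by (metis imageI real_norm_def)
  define K where "K = minorants \<phi> \<inter> {\<sigma>. - M \<le> mpair \<eta> \<sigma>}"
  \<comment> \<open>By the sign of the time component in the pairing, (M, 0, 0) is the constant
    function -M.\<close>
  have init: "(M, 0, 0) \<in> K"
    using M by (force simp: K_def minorants_def mpair_def)
  have bound: "norm \<sigma> \<le> \<bar>M\<bar> + 2 * (2 * M / (1 - cmod \<eta>))" if "\<sigma> \<in> K" for \<sigma>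
  proof -
    \<comment> \<open>The gap below the constant M: nonnegative on the circle, hence causal, and at
      most 2 M at \<open>\<eta>\<close>. Since |\<eta>| < 1, this bounds its time component.\<close>
    define \<rho> where "\<rho> = - \<sigma> - (M, 0, 0)"
    have \<rho>: "mpair z \<rho> = M - mpair z \<sigma>" for z
      by (simp add: \<rho>_def mpair_linear) (simp add: mpair_def)
    have "0 \<le> mpair z \<rho>" if "z \<in> sphere 0 1" for z
      using \<open>\<sigma> \<in> K\<close> M[OF that] that by (force simp: \<rho> K_def minorants_def)
    then have causal: "norm (snd \<rho>) \<le> - fst \<rho>" by (rule causal_if_nonneg)
    have "mpair \<eta> \<rho> \<le> 2 * M" using \<open>\<sigma> \<in> K\<close> by (simp add: \<rho> K_def)
    moreover have "norm (snd \<rho>) * cmod \<eta> \<le> - fst \<rho> * cmod \<eta>"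
      by (intro mult_right_mono causal) simp
    ultimately have "- fst \<rho> * (1 - cmod \<eta>) \<le> 2 * M"
      using mpair_ge[of \<rho> \<eta>] by (simp add: algebra_simps)
    then have "- fst \<rho> \<le> 2 * M / (1 - cmod \<eta>)"
      using \<eta> by (simp add: field_simps)
    moreover have "norm \<rho> \<le> norm (fst \<rho>) + norm (snd \<rho>)"
      by (metis norm_Pair_le prod.collapse)
    ultimately have "norm \<rho> \<le> 2 * (2 * M / (1 - cmod \<eta>))"
      using causal norm_ge_zero[of "snd \<rho>"] by simp
    moreover have "norm \<sigma> \<le> norm \<rho> + norm (M, 0::real, 0::real)"
      using norm_triangle_ineq[of \<rho> "(M, 0, 0)"] by (simp add: \<rho>_def)
    ultimately show ?thesis by (simp add: norm_Pair)
  qed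
  have "closed K"
  proof -
    have "K = (\<Inter>z\<in>sphere 0 1. {\<sigma>. mpair z \<sigma> \<le> \<phi> z}) \<inter> {\<sigma>. - M \<le> mpair \<eta> \<sigma>}"
      by (auto simp: K_def minorants_def)
    then show ?thesis
      by (simp add: closed_INT closed_Int closed_Collect_le continuous_on_mpair_right)
  qed
  moreover have "bounded K" using bound unfolding bounded_iff by blast
  ultimately have "compact K" by (simp add: compact_eq_bounded_closed)
  with init obtain \<sigma> where \<sigma>: "\<sigma> \<in> K" "\<And>\<tau>. \<tau> \<in> K \<Longrightarrow> mpair \<eta> \<tau> \<le> mpair \<eta> \<sigma>"
    using continuous_attains_sup[of K "mpair \<eta>"] continuous_on_mpair_right by blast
  show thesis
  proof
    show "\<sigma> \<in> minorants \<phi>" using \<sigma>(1) by (simp add: K_def)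
    show "mpair \<eta> \<tau> \<le> mpair \<eta> \<sigma>" if "\<tau> \<in> minorants \<phi>" for \<tau>
      using \<sigma> that by (cases "\<tau> \<in> K") (auto simp: K_def)
  qed
qed

lemma phi_lower_attained:
  assumes "\<sigma> \<in> minorants \<phi>" "\<And>\<tau>. \<tau> \<in> minorants \<phi> \<Longrightarrow> mpair \<eta> \<tau> \<le> mpair \<eta> \<sigma>"
  shows "phi_lower \<phi> \<eta> = mpair \<eta> \<sigma>"
  unfolding phi_lower_eq_Sup using assms by (intro cSup_eq_maximum) auto

lemma phi_lower_ge:
  assumes "continuous_on (sphere 0 1) \<phi>" "\<sigma> \<in> minorants \<phi>" "\<eta> \<in> ball 0 1"
  shows "mpair \<eta> \<sigma> \<le> phi_lower \<phi> \<eta>"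
  by (metis assms extremal_minorant_exists phi_lower_attained)

text \<open>\<open>Sigma_lower\<close> compares planes inside the disk. The plane chosen here also
  stays below \<open>\<phi>\<close> on the circle, as the causality arguments require.\<close>

lemma Sigma_lower_minorant_exists:
  assumes "continuous_on (sphere 0 1) \<phi>" "\<eta> \<in> ball 0 1"
  obtains \<sigma> where "\<sigma> \<in> minorants \<phi>" "\<sigma> \<in> Sigma_lower \<phi> \<eta>"
    "\<And>\<tau>. \<tau> \<in> minorants \<phi> \<Longrightarrow> mpair \<eta> \<tau> \<le> mpair \<eta> \<sigma>"
proof -
  obtain \<sigma> where \<sigma>: "\<sigma> \<in> minorants \<phi>"
    "\<And>\<tau>. \<tau> \<in> minorants \<phi> \<Longrightarrow> mpair \<eta> \<tau> \<le> mpair \<eta> \<sigma>"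
    using extremal_minorant_exists[OF assms] by blast
  then have "\<sigma> \<in> Sigma_lower \<phi> \<eta>"
    using phi_lower_ge[OF assms(1) \<sigma>(1)] phi_lower_attained[of \<sigma> \<phi> \<eta>] by (simp add: Sigma_lower_def)
  with \<sigma> that show thesis by blast
qed

lemma phi_upper_le:
  assumes "continuous_on (sphere 0 1) \<phi>" "\<eta> \<in> ball 0 1"
    and "\<And>z. z \<in> sphere 0 1 \<Longrightarrow> \<phi> z \<le> mpair z \<sigma>"
  shows "phi_upper \<phi> \<eta> \<le> mpair \<eta> \<sigma>"
proof -
  have "- \<sigma> \<in> minorants (\<lambda>z. - \<phi> z)" using assms(3) by (simp add: minorants_def mpair_minus)
  then have "mpair \<eta> (- \<sigma>) \<le> phi_lower (\<lambda>z. - \<phi> z) \<eta>"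
    by (intro phi_lower_ge assms continuous_intros)
  then show ?thesis by (simp add: phi_upper_eq mpair_minus)
qed

lemma phi_upper_attained:
  assumes "continuous_on (sphere 0 1) \<phi>" "\<eta> \<in> ball 0 1"
  obtains \<sigma> where "\<And>z. z \<in> sphere 0 1 \<Longrightarrow> \<phi> z \<le> mpair z \<sigma>" "phi_upper \<phi> \<eta> = mpair \<eta> \<sigma>"
proof -
  have "continuous_on (sphere 0 1) (\<lambda>z. - \<phi> z)" by (intro continuous_intros assms)
  then obtain \<sigma> where "\<sigma> \<in> minorants (\<lambda>z. - \<phi> z)"
    "\<And>\<tau>. \<tau> \<in> minorants (\<lambda>z. - \<phi> z) \<Longrightarrow> mpair \<eta> \<tau> \<le> mpair \<eta> \<sigma>"
    using extremal_minorant_exists assms(2) by blast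
  then have "phi_upper \<phi> \<eta> = mpair \<eta> (- \<sigma>)" "\<sigma> \<in> minorants (\<lambda>z. - \<phi> z)"
    using phi_lower_attained[of \<sigma> "\<lambda>z. - \<phi> z" \<eta>] by (auto simp: phi_upper_eq mpair_minus)
  then show thesis
    by (intro that[of "- \<sigma>"]) (force simp: minorants_def mpair_minus)+
qed

section \<open>Bending and width\<close>

lemma width_ge:
  assumes "\<eta> \<in> ball 0 1" "r * sqrt (1 - (cmod \<eta>)\<^sup>2) \<le> phi_upper \<phi> \<eta> - phi_lower \<phi> \<eta>"
  shows "ereal r \<le> width \<phi>"
proof -
  have "(cmod \<eta>)\<^sup>2 < 1" using assms(1) by (simp add: power_less_one_iff)
  then have "r \<le> (phi_upper \<phi> \<eta> - phi_lower \<phi> \<eta>) / sqrt (1 - (cmod \<eta>)\<^sup>2)"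
    using assms(2) by (simp add: pos_le_divide_eq)
  then have "ereal r \<le> ereal ((phi_upper \<phi> \<eta> - phi_lower \<phi> \<eta>) / sqrt (1 - (cmod \<eta>)\<^sup>2))"
    by simp
  also have "\<dots> \<le> width \<phi>"
    unfolding width_def using assms(1) by (intro Sup_upper) blast
  finally show ?thesis .
qed

lemma width_minus: "width (\<lambda>z. - \<phi> z) = width \<phi>"
proof -
  have "phi_upper (\<lambda>z. - \<phi> z) \<eta> - phi_lower (\<lambda>z. - \<phi> z) \<eta> = phi_upper \<phi> \<eta> - phi_lower \<phi> \<eta>" for \<eta>
    by (simp add: phi_upper_eq)
  then show ?thesis by (simp add: width_def)
qed

text \<open>Reverse Cauchy-Schwarz: (1, \<eta>) has Minkowski length sqrt (1 - |\<eta>|^2) and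
  \<open>\<sigma>\<close> has length at least |k|. It reduces to planar Cauchy-Schwarz for (k, n)
  and the unit vector (s, r).\<close>

lemma mpair_ge_timelike:
  assumes "cmod \<eta> < 1" "0 \<le> - fst \<sigma>" "(norm (snd \<sigma>))\<^sup>2 + k\<^sup>2 \<le> (fst \<sigma>)\<^sup>2"
  shows "k * sqrt (1 - (cmod \<eta>)\<^sup>2) \<le> mpair \<eta> \<sigma>"
proof -
  define n r s where "n = norm (snd \<sigma>)" and "r = cmod \<eta>" and "s = sqrt (1 - r\<^sup>2)"
  have "r\<^sup>2 \<le> 1" using assms(1) by (simp add: r_def power_le_one)
  then have s: "s\<^sup>2 = 1 - r\<^sup>2" by (simp add: s_def)
  have "(k * s + n * r)\<^sup>2 = (k\<^sup>2 + n\<^sup>2) * (s\<^sup>2 + r\<^sup>2) - (k * r - n * s)\<^sup>2"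
    by (simp add: power2_eq_square algebra_simps)
  also have "\<dots> \<le> n\<^sup>2 + k\<^sup>2" by (simp add: s)
  also have "\<dots> \<le> (- fst \<sigma>)\<^sup>2" using assms(3) by (simp add: n_def)
  finally have "k * s + n * r \<le> - fst \<sigma>"
    using assms(2) by (rule power2_le_imp_le)
  then show ?thesis
    using mpair_ge[of \<sigma> \<eta>] by (simp add: n_def r_def s_def)
qed

lemma norm_snd_sq: "(norm (snd \<sigma>))\<^sup>2 = (fst (snd \<sigma>))\<^sup>2 + (snd (snd \<sigma>))\<^sup>2"
  for \<sigma> :: mvec
  by (simp add: norm_prod_def)

text \<open>If \<open>\<beta>\<close> dominates both planes on the circle, then \<open>\<beta> - \<sigma>\<close> and \<open>\<beta> - \<tau>\<close> are causal, so
  their midpoint is timelike of length at least half the length of the spacelike \<open>\<sigma> - \<tau>\<close>.\<close>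
lemma dominating_plane_ge:
  assumes \<sigma>: "\<And>z. z \<in> sphere 0 1 \<Longrightarrow> mpair z \<sigma> \<le> mpair z \<beta>"
    and \<tau>: "\<And>z. z \<in> sphere 0 1 \<Longrightarrow> mpair z \<tau> \<le> mpair z \<beta>"
    and m: "m\<^sup>2 = msq \<sigma> \<tau>" and \<eta>: "cmod \<eta> < 1"
  shows "m / 2 * sqrt (1 - (cmod \<eta>)\<^sup>2) + (mpair \<eta> \<tau> - mpair \<eta> \<sigma>) / 2 \<le> mpair \<eta> \<beta> - mpair \<eta> \<sigma>"
proof -
  define \<gamma> where "\<gamma> = \<beta> - (1/2) *\<^sub>R (\<sigma> + \<tau>)"
  have c1: "norm (snd (\<beta> - \<sigma>)) \<le> - fst (\<beta> - \<sigma>)"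
    by (rule causal_if_nonneg) (simp add: mpair_linear \<sigma>)
  have c2: "norm (snd (\<beta> - \<tau>)) \<le> - fst (\<beta> - \<tau>)"
    by (rule causal_if_nonneg) (simp add: mpair_linear \<tau>)
  have "(norm (snd (\<beta> - \<sigma>)))\<^sup>2 \<le> (- fst (\<beta> - \<sigma>))\<^sup>2" "(norm (snd (\<beta> - \<tau>)))\<^sup>2 \<le> (- fst (\<beta> - \<tau>))\<^sup>2"
    using c1 c2 by (auto intro: power_mono)
  \<comment> \<open>Parallelogram law of the Minkowski form for \<open>\<beta> - \<sigma>\<close>
    and \<open>\<beta> - \<tau>\<close>, whose difference has square m^2.\<close>
  moreover have "(fst \<gamma>)\<^sup>2 - ((norm (snd \<gamma>))\<^sup>2 + (m / 2)\<^sup>2)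
      = ((- fst (\<beta> - \<sigma>))\<^sup>2 - (norm (snd (\<beta> - \<sigma>)))\<^sup>2
        + ((- fst (\<beta> - \<tau>))\<^sup>2 - (norm (snd (\<beta> - \<tau>)))\<^sup>2)) / 2"
    unfolding norm_snd_sq power_divide m
    by (simp add: \<gamma>_def msq_def power2_eq_square field_simps)
  ultimately have "(norm (snd \<gamma>))\<^sup>2 + (m / 2)\<^sup>2 \<le> (fst \<gamma>)\<^sup>2"
    by simp
  moreover have "0 \<le> - fst \<gamma>"
    using order_trans[OF norm_ge_zero c1] order_trans[OF norm_ge_zero c2]
    by (simp add: \<gamma>_def)
  ultimately have "m / 2 * sqrt (1 - (cmod \<eta>)\<^sup>2) \<le> mpair \<eta> \<gamma>"
    using \<eta> mpair_ge_timelike by blast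
  then show ?thesis by (simp add: \<gamma>_def mpair_linear field_simps)
qed

text \<open>The Gram determinant of three vectors of \<open>\<real>\<^sup>1\<^sup>,\<^sup>2\<close> is minus a square.\<close>
lemma gram_ineq:
  fixes p q :: complex and \<sigma> \<tau> :: mvec
  defines "x \<equiv> mpair p \<sigma> - mpair p \<tau>" and "y \<equiv> mpair q \<tau> - mpair q \<sigma>"
    and "A \<equiv> 1 - (cmod p)\<^sup>2" and "B \<equiv> 1 - (cmod q)\<^sup>2" and "K \<equiv> 1 - p \<bullet> q"
  shows "x\<^sup>2 * B + y\<^sup>2 * A + 2 * K * x * y \<le> msq \<sigma> \<tau> * (K\<^sup>2 - A * B)"
proof -
  obtain p1 p2 where p: "p = Complex p1 p2" by (cases p)
  obtain q1 q2 where q: "q = Complex q1 q2" by (cases q)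
  obtain t0 t1 t2 where t: "\<tau> - \<sigma> = (t0, t1, t2)" by (metis prod.exhaust)
  have x: "x = t0 - p1 * t1 - p2 * t2" and y: "y = - t0 + q1 * t1 + q2 * t2"
    using t unfolding x_def y_def mpair_def p q
    by (auto simp: prod_eq_iff algebra_simps)
  have m: "msq \<sigma> \<tau> = - t0\<^sup>2 + t1\<^sup>2 + t2\<^sup>2"
    using t by (auto simp: msq_def prod_eq_iff power2_commute)
  have A: "A = 1 - p1\<^sup>2 - p2\<^sup>2" and B: "B = 1 - q1\<^sup>2 - q2\<^sup>2" and K: "K = 1 - p1 * q1 - p2 * q2"
    by (simp_all add: A_def B_def K_def p q cmod_power2 inner_complex_def)
  \<comment> \<open>The squared expression is the determinant of (1, p), (1, q) and
    \<open>\<tau> - \<sigma>\<close>.\<close>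
  have "msq \<sigma> \<tau> * (K\<^sup>2 - A * B) - (x\<^sup>2 * B + y\<^sup>2 * A + 2 * K * x * y)
      = ((q1 * t2 - q2 * t1) - p1 * (t2 - q2 * t0) + p2 * (t1 - q1 * t0))\<^sup>2"
    unfolding x y m A B K by (simp add: power2_eq_square algebra_simps)
  then show ?thesis by (smt (verit) zero_le_power2)
qed

text \<open>The first bound puts the argument of \<open>arcosh\<close> in its range, so 1 - p
  \<bullet> q = cosh 1 * s. Then exp 1 \<le> 3 and exp (-1) \<le> 1/2 give cosh 1 \<le> 7/4.\<close>

lemma klein_dist_bounds:
  assumes "p \<in> ball 0 1" "q \<in> ball 0 1" "klein_dist p q = 1"
  defines "s \<equiv> sqrt ((1 - (cmod p)\<^sup>2) * (1 - (cmod q)\<^sup>2))"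
  shows "s \<le> 1 - p \<bullet> q" "1 - p \<bullet> q \<le> 7 / 4 * s" "0 < s"
proof -
  define A B where "A = 1 - (cmod p)\<^sup>2" and "B = 1 - (cmod q)\<^sup>2"
  have AB: "0 < A" "0 < B"
    using assms(1,2) by (auto simp: A_def B_def power_less_one_iff)
  then show s: "0 < s" by (simp add: s_def A_def B_def)
  have cs: "p \<bullet> q \<le> cmod p * cmod q" by (rule norm_cauchy_schwarz)
  have le1: "cmod p * cmod q \<le> 1" using assms(1,2) by (intro mult_le_one) auto
  from cs le1 have "0 \<le> 1 - p \<bullet> q" by simp
  moreover have "s\<^sup>2 \<le> (1 - p \<bullet> q)\<^sup>2"
  proof -
    have "(1 - cmod p * cmod q)\<^sup>2 \<le> (1 - p \<bullet> q)\<^sup>2"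
      using cs le1 by (intro power_mono) auto
    moreover have "s\<^sup>2 = (1 - cmod p * cmod q)\<^sup>2 - (cmod p - cmod q)\<^sup>2"
      using AB by (simp add: s_def A_def B_def) (simp add: power2_eq_square algebra_simps)
    ultimately show ?thesis by (smt (verit) zero_le_power2)
  qed
  ultimately show le: "s \<le> 1 - p \<bullet> q" by (rule power2_le_imp_le[rotated])
  then have "cosh (klein_dist p q) = (1 - p \<bullet> q) / s"
    using s by (simp add: klein_dist_def flip: s_def)
  then have "1 - p \<bullet> q = cosh 1 * s" using assms(3) s by (simp add: field_simps)
  moreover have "cosh (1::real) \<le> 7 / 4"
  proof -
    have "exp (- 1) \<le> (1 / 2 :: real)"
      using exp_ge_add_one_self[of "1::real"] by (simp add: exp_minus field_simps)
    then show ?thesis using exp_le by (simp add: cosh_def)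
  qed
  ultimately show "1 - p \<bullet> q \<le> 7 / 4 * s" using s by (simp add: mult_right_mono)
qed

text \<open>Writing \<open>x\<close>, \<open>y\<close> for the two pairings, the hyperbolic distances \<open>d\<close>, \<open>d'\<close> of \<open>p\<close>, \<open>q\<close> to the
  bending line satisfy \<open>x = m * sqrt A * sinh d\<close>, \<open>y = m * sqrt B * sinh d'\<close> and \<open>d + d' \<le> 1\<close>, so one
  of them is at most \<open>1/2\<close>; and \<open>sinh (1/2) < 13/20\<close>.\<close>
lemma one_endpoint_near_bending_line:
  fixes A B K m x y :: real
  assumes "A > 0" "B > 0" "m > 0" and s: "s = sqrt (A * B)" and K: "s \<le> K" "K \<le> 7 / 4 * s"
    and gram: "x\<^sup>2 * B + y\<^sup>2 * A + 2 * K * x * y \<le> m\<^sup>2 * (K\<^sup>2 - A * B)"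
  shows "x \<le> 13 / 20 * m * sqrt A \<or> y \<le> 13 / 20 * m * sqrt B"
proof (rule ccontr)
  assume "\<not> ?thesis"
  then have x: "13 / 20 * m * sqrt A < x" and y: "13 / 20 * m * sqrt B < y" by auto
  have s2: "s > 0" "s\<^sup>2 = A * B" "s = sqrt A * sqrt B"
    using assms(1,2) by (simp_all add: s real_sqrt_mult power_mult_distrib)
  have "(13 / 20 * m * sqrt A)\<^sup>2 < x\<^sup>2" "(13 / 20 * m * sqrt B)\<^sup>2 < y\<^sup>2"
    using x y assms(1-3) by (auto intro!: power_strict_mono)
  then have "169 / 400 * m\<^sup>2 * A < x\<^sup>2" "169 / 400 * m\<^sup>2 * B < y\<^sup>2"
    using assms(1-3) by (auto simp: power_mult_distrib power_divide)
  then have 1: "169 / 400 * m\<^sup>2 * A * B < x\<^sup>2 * B" "169 / 400 * m\<^sup>2 * B * A < y\<^sup>2 * A"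
    using assms(1-3) by (auto intro: mult_strict_right_mono)
  have "(13 / 20 * m * sqrt A) * (13 / 20 * m * sqrt B) \<le> x * y"
    using x y assms(1-3) by (intro mult_mono) (auto intro: order_trans[OF _ less_imp_le[OF x]])
  then have "169 / 400 * m\<^sup>2 * s \<le> x * y" by (simp add: s2(3) power2_eq_square mult_ac)
  then have "K * (169 / 400 * m\<^sup>2 * s) \<le> K * (x * y)"
    using K s2 by (intro mult_left_mono) auto
  with 1 have "169 / 200 * m\<^sup>2 * s\<^sup>2 + 169 / 200 * m\<^sup>2 * s * K
      < x\<^sup>2 * B + y\<^sup>2 * A + 2 * K * x * y"
    by (simp add: s2(2) algebra_simps)
  then have "169 / 200 * m\<^sup>2 * s\<^sup>2 + 169 / 200 * m\<^sup>2 * s * K < m\<^sup>2 * (K\<^sup>2 - s\<^sup>2)"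
    using gram by (simp add: s2(2))
  then have "(m\<^sup>2 * (s + K)) * (169 / 200 * s) < (m\<^sup>2 * (s + K)) * (K - s)"
    by (simp add: power2_eq_square field_simps)
  moreover have "0 < m\<^sup>2 * (s + K)" using assms(3) s2(1) K by simp
  \<comment> \<open>Contradiction: K - s \<le> 3/4 s, while 2 (13/20)^2 = 169/200 > 3/4. This is the
    numerical form of cosh 1 - 1 = 2 sinh(1/2)^2.\<close>
  ultimately have "169 / 200 * s < K - s" by (simp only: mult_less_cancel_left_pos)
  then show False using K s2(1) by linarith
qed

text \<open>7/40 = (1 - 13/20) / 2 is the fraction of m left as normalised height at the endpoint
  near the bending line.\<close>

lemma thurston_constant_le: "(1 - tanh 1) / (2 * sqrt 2) \<le> (7 / 40 :: real)"
  and thurston_constant_pos: "0 < (1 - tanh 1) / (2 * sqrt 2 :: real)"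
proof -
  have e: "exp (1::real) \<ge> 2" using exp_ge_add_one_self[of "1::real"] by simp
  have "exp 1 + exp (- 1) \<noteq> (0::real)" by (smt (verit) exp_gt_zero)
  then have "(1::real) - tanh 1 = 2 * exp (- 1) / (exp 1 + exp (- 1))"
    by (simp add: tanh_altdef divide_simps)
  also have "\<dots> \<le> 2 / 5"
  proof -
    have "4 * exp (- 1) \<le> exp (1::real)"
      using mult_mono[OF e e] e by (simp add: exp_minus field_simps)
    then show ?thesis by (simp add: divide_le_eq add_pos_pos)
  qed
  finally have "1 - tanh 1 \<le> (2 / 5 :: real)" .
  moreover have "sqrt 2 \<ge> (7 / 5 :: real)"
    by (rule real_le_rsqrt) (simp add: power2_eq_square)
  ultimately show "(1 - tanh 1) / (2 * sqrt 2) \<le> (7 / 40 :: real)"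
    by (simp add: divide_le_eq)
  show "0 < (1 - tanh 1) / (2 * sqrt 2 :: real)"
    using tanh_real_lt_1[of 1] by simp
qed

text \<open>The gap is measured at whichever endpoint is near the bending line; the optimal majorant
  there dominates both support planes.\<close>

lemma support_planes_le_width:
  assumes cont: "continuous_on (sphere 0 1) \<phi>"
    and p: "p \<in> ball 0 1" and q: "q \<in> ball 0 1" and pq: "klein_dist p q = 1"
  shows "\<exists>\<sigma>\<in>Sigma_lower \<phi> p. \<exists>\<tau>\<in>Sigma_lower \<phi> q.
    ereal ((1 - tanh 1) / (2 * sqrt 2) * sqrt (msq \<sigma> \<tau>)) \<le> width \<phi>"
proof -
  obtain \<sigma> where \<sigma>: "\<sigma> \<in> minorants \<phi>" "\<sigma> \<in> Sigma_lower \<phi> p"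
    "\<And>\<tau>. \<tau> \<in> minorants \<phi> \<Longrightarrow> mpair p \<tau> \<le> mpair p \<sigma>"
    using Sigma_lower_minorant_exists[OF cont p] by blast
  obtain \<tau> where \<tau>: "\<tau> \<in> minorants \<phi>" "\<tau> \<in> Sigma_lower \<phi> q"
    "\<And>\<sigma>. \<sigma> \<in> minorants \<phi> \<Longrightarrow> mpair q \<sigma> \<le> mpair q \<tau>"
    using Sigma_lower_minorant_exists[OF cont q] by blast
  obtain \<beta> where \<beta>: "\<And>z. z \<in> sphere 0 1 \<Longrightarrow> \<phi> z \<le> mpair z \<beta>" "phi_upper \<phi> p = mpair p \<beta>"
    using phi_upper_attained[OF cont p] by blast
  obtain \<beta>' where \<beta>': "\<And>z. z \<in> sphere 0 1 \<Longrightarrow> \<phi> z \<le> mpair z \<beta>'" "phi_upper \<phi> q = mpair q \<beta>'"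
    using phi_upper_attained[OF cont q] by blast
  have lo: "phi_lower \<phi> p = mpair p \<sigma>" "phi_lower \<phi> q = mpair q \<tau>"
    using \<sigma>(2) \<tau>(2) by (auto simp: Sigma_lower_def)
  have dom: "mpair z \<sigma> \<le> mpair z \<beta>" "mpair z \<tau> \<le> mpair z \<beta>"
    "mpair z \<sigma> \<le> mpair z \<beta>'" "mpair z \<tau> \<le> mpair z \<beta>'" if "z \<in> sphere 0 1" for z
  proof -
    have "mpair z \<sigma> \<le> \<phi> z" "mpair z \<tau> \<le> \<phi> z"
      using \<sigma>(1) \<tau>(1) that by (simp_all add: minorants_def)
    then show "mpair z \<sigma> \<le> mpair z \<beta>" "mpair z \<tau> \<le> mpair z \<beta>"
      "mpair z \<sigma> \<le> mpair z \<beta>'" "mpair z \<tau> \<le> mpair z \<beta>'"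
      using \<beta>(1)[OF that] \<beta>'(1)[OF that] by linarith+
  qed
  define m where "m = sqrt (msq \<sigma> \<tau>)"
  define k :: real where "k = (1 - tanh 1) / (2 * sqrt 2)"
  have k: "0 < k" "k \<le> 7 / 40"
    unfolding k_def by (rule thurston_constant_pos thurston_constant_le)+
  have "ereal (k * m) \<le> width \<phi>"
  proof (cases "m > 0")
    \<comment> \<open>\<open>sqrt\<close> is odd, so this case covers null and timelike differences;
      nonnegativity of the width then suffices.\<close>
    case False
    have "0 \<le> mpair p (\<beta> - \<sigma>)"
    proof (rule mpair_nonneg_cball)
      show "0 \<le> mpair z (\<beta> - \<sigma>)" if "z \<in> sphere 0 1" for z
        using dom(1)[OF that] by (simp add: mpair_diff)
      show "p \<in> cball 0 1" using p by simp
    qed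
    then have "ereal 0 \<le> width \<phi>"
      by (intro width_ge[OF p]) (simp add: \<beta>(2) lo mpair_linear)
    moreover have "k * m \<le> 0"
      using False k(1) by (simp add: mult_nonneg_nonpos)
    ultimately show ?thesis using order_trans by (metis ereal_less_eq(3))
  next
    case True
    then have m2: "m\<^sup>2 = msq \<sigma> \<tau>" "m\<^sup>2 = msq \<tau> \<sigma>"
      by (auto simp: m_def msq_def power2_commute)
    define A B where "A = 1 - (cmod p)\<^sup>2" and "B = 1 - (cmod q)\<^sup>2"
    have AB: "A > 0" "B > 0"
      using p q by (auto simp: A_def B_def power_less_one_iff)
    have km: "k * m \<le> 7 / 40 * m"
      using True k(2) by (simp add: mult_right_mono)
    have "mpair p \<sigma> - mpair p \<tau> \<le> 13 / 20 * m * sqrt A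
        \<or> mpair q \<tau> - mpair q \<sigma> \<le> 13 / 20 * m * sqrt B"
    proof (rule one_endpoint_near_bending_line[OF AB True refl])
      show "sqrt (A * B) \<le> 1 - p \<bullet> q" "1 - p \<bullet> q \<le> 7 / 4 * sqrt (A * B)"
        unfolding A_def B_def by (rule klein_dist_bounds[OF p q pq])+
      show "(mpair p \<sigma> - mpair p \<tau>)\<^sup>2 * B + (mpair q \<tau> - mpair q \<sigma>)\<^sup>2 * A
          + 2 * (1 - p \<bullet> q) * (mpair p \<sigma> - mpair p \<tau>) * (mpair q \<tau> - mpair q \<sigma>)
        \<le> m\<^sup>2 * ((1 - p \<bullet> q)\<^sup>2 - A * B)"
        unfolding m2(1) A_def B_def by (rule gram_ineq)
    qed
    then show ?thesis
    proof
      assume *: "mpair p \<sigma> - mpair p \<tau> \<le> 13 / 20 * m * sqrt A"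
      have "m / 2 * sqrt A + (mpair p \<tau> - mpair p \<sigma>) / 2 \<le> mpair p \<beta> - mpair p \<sigma>"
        unfolding A_def using p by (intro dominating_plane_ge m2 dom) simp_all
      with * have "7 / 40 * m * sqrt A \<le> mpair p \<beta> - mpair p \<sigma>" by (simp add: field_simps)
      moreover have "k * m * sqrt A \<le> 7 / 40 * m * sqrt A"
        using AB by (intro mult_right_mono km) simp
      ultimately show ?thesis
        by (intro width_ge[OF p]) (simp add: \<beta>(2) lo flip: A_def)
    next
      assume *: "mpair q \<tau> - mpair q \<sigma> \<le> 13 / 20 * m * sqrt B"
      have "m / 2 * sqrt B + (mpair q \<sigma> - mpair q \<tau>) / 2 \<le> mpair q \<beta>' - mpair q \<tau>"
        unfolding B_def using q by (intro dominating_plane_ge m2 dom) simp_all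
      with * have "7 / 40 * m * sqrt B \<le> mpair q \<beta>' - mpair q \<tau>" by (simp add: field_simps)
      moreover have "k * m * sqrt B \<le> 7 / 40 * m * sqrt B"
        using AB by (intro mult_right_mono km) simp
      ultimately show ?thesis
        by (intro width_ge[OF q]) (simp add: \<beta>'(2) lo flip: B_def)
    qed
  qed
  then show ?thesis using \<sigma>(2) \<tau>(2) unfolding m_def k_def by blast
qed

section \<open>From pairs of support planes to the Thurston norm\<close>

lemma bend_le:
  assumes "\<sigma> \<in> Sig (c 0)" "\<tau> \<in> Sig (c 1)"
  shows "bend Sig c \<le> ereal (sqrt (msq \<sigma> \<tau>))"
proof -
  \<comment> \<open>The subdivision with the single step n = 1; its times are given by the embedding
    \<open>real\<close> of the naturals.\<close>
  have "\<exists>n t s. ereal (sqrt (msq \<sigma> \<tau>)) = ereal (\<Sum>i<n. sqrt (msq (s i) (s (Suc i))))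
      \<and> t 0 = 0 \<and> t n = 1 \<and> (\<forall>i<n. t i < t (Suc i)) \<and> (\<forall>i\<le>n. s i \<in> Sig (c (t i)))"
    using assms
    by (intro exI[of _ "1::nat"] exI[of _ real] exI[of _ "\<lambda>i. if i = 0 then \<sigma> else \<tau>"])
       (auto simp: le_Suc_eq)
  then show ?thesis unfolding bend_def by (intro Inf_lower) simp
qed

text \<open>Stated for arbitrary \<open>Sig\<close> and \<open>h\<close> so that both measures share
  it. Dividing by \<open>k\<close> leaves a bound on each bending in the supremum.\<close>

lemma thurston_norm_le_width:
  assumes "\<And>p q. p \<in> ball 0 1 \<Longrightarrow> q \<in> ball 0 1 \<Longrightarrow> klein_dist p q = 1 \<Longrightarrow>
    \<exists>\<sigma>\<in>Sig p. \<exists>\<tau>\<in>Sig q. ereal (k * sqrt (msq \<sigma> \<tau>)) \<le> W" and "k > 0"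
  shows "ereal k * thurston_norm Sig h \<le> W"
proof -
  have "thurston_norm Sig h \<le> W / ereal k"
    unfolding thurston_norm_def
  proof (rule Sup_least, clarify)
    fix p q :: complex
    assume "p \<in> ball 0 1" "q \<in> ball 0 1" "klein_dist p q = 1"
    then obtain \<sigma> \<tau> where st: "\<sigma> \<in> Sig p" "\<tau> \<in> Sig q" "ereal k * ereal (sqrt (msq \<sigma> \<tau>)) \<le> W"
      using assms(1) by fastforce
    have "bend Sig (\<lambda>t. p + t *\<^sub>R (q - p)) \<le> ereal (sqrt (msq \<sigma> \<tau>))"
      using st by (intro bend_le) auto
    also have "\<dots> \<le> W / ereal k"
      using st(3) assms(2) by (subst ereal_le_divide_pos) auto
    finally show "bend Sig (\<lambda>t. p + t *\<^sub>R (q - p)) \<le> W / ereal k" .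
  qed
  then show ?thesis using assms(2) by (subst (asm) ereal_le_divide_pos) auto
qed

lemma Sigma_upper_minus: "\<sigma> \<in> Sigma_lower (\<lambda>z. - \<phi> z) \<eta> \<Longrightarrow> - \<sigma> \<in> Sigma_upper \<phi> \<eta>"
  by (simp add: Sigma_lower_def Sigma_upper_def phi_upper_eq mpair_minus)

lemma thurston_lower_le_width:
  assumes "continuous_on (sphere 0 1) \<phi>"
  shows "ereal ((1 - tanh 1) / (2 * sqrt 2)) * thurston_norm (Sigma_lower \<phi>) h \<le> width \<phi>"
  by (rule thurston_norm_le_width[OF support_planes_le_width[OF assms] thurston_constant_pos])

text \<open>Apply the lower case to \<open>- \<phi>\<close>: negation preserves both the width and
  \<open>msq\<close>.\<close>

lemma thurston_upper_le_width:
  assumes "continuous_on (sphere 0 1) \<phi>"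
  shows "ereal ((1 - tanh 1) / (2 * sqrt 2)) * thurston_norm (Sigma_upper \<phi>) h \<le> width \<phi>"
proof (rule thurston_norm_le_width[OF _ thurston_constant_pos])
  fix p q :: complex
  assume pq: "p \<in> ball 0 1" "q \<in> ball 0 1" "klein_dist p q = 1"
  have "continuous_on (sphere 0 1) (\<lambda>z. - \<phi> z)" by (intro continuous_intros assms)
  from support_planes_le_width[OF this pq] obtain \<sigma> \<tau>
    where st: "- \<sigma> \<in> Sigma_upper \<phi> p" "- \<tau> \<in> Sigma_upper \<phi> q"
      "ereal ((1 - tanh 1) / (2 * sqrt 2) * sqrt (msq \<sigma> \<tau>)) \<le> width \<phi>"
    using Sigma_upper_minus by (metis width_minus)
  moreover have "msq (- \<sigma>) (- \<tau>) = msq \<sigma> \<tau>"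
    by (simp add: msq_def power2_commute)
  ultimately show "\<exists>\<sigma>\<in>Sigma_upper \<phi> p. \<exists>\<tau>\<in>Sigma_upper \<phi> q.
      ereal ((1 - tanh 1) / (2 * sqrt 2) * sqrt (msq \<sigma> \<tau>)) \<le> width \<phi>"
    by metis
qed

section \<open>Width and cross-ratio norm\<close>

text \<open>The fourth point \<open>d\<close> is the harmonic conjugate of \<open>b\<close> with respect to \<open>a\<close> and \<open>c\<close>.\<close>
lemma Xbracket_harmonic:
  fixes X :: "real \<Rightarrow> real" and a u v :: real
  assumes nz: "u \<noteq> 0" "v \<noteq> 0" "u + v \<noteq> 0" "u \<noteq> v"
  obtains d where "cross_ratio a (a + u) (a + u + v) d = 1"
    "Xbracket X a (a + u) (a + u + v) d * (u * v * (u + v))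
      = (u + v)\<^sup>2 * X (a + u) - 2 * v\<^sup>2 * X a - 2 * u\<^sup>2 * X (a + u + v) + (u - v)\<^sup>2 * X d"
proof
  \<comment> \<open>The root of u (d - a - u - v) = v (d - a), which expresses cross-ratio 1; u = v
    would put it at infinity.\<close>
  define d where "d = a + (u + v) * u / (u - v)"
  have da: "d - a = (u + v) * u / (u - v)" "a - d = - ((u + v) * u / (u - v))" by (simp_all add: d_def)
  have dc: "d - (a + u + v) = (u + v) * v / (u - v)"
    using nz by (simp add: d_def field_simps)
  show "cross_ratio a (a + u) (a + u + v) d = 1"
    unfolding cross_ratio_def da dc using nz by simp
  show "Xbracket X a (a + u) (a + u + v) d * (u * v * (u + v))
      = (u + v)\<^sup>2 * X (a + u) - 2 * v\<^sup>2 * X a - 2 * u\<^sup>2 * X (a + u + v) + (u - v)\<^sup>2 * X d"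
    unfolding Xbracket_def da dc using nz by (simp add: divide_simps) algebra
qed

lemma three_point_ineq_line:
  fixes X :: "real \<Rightarrow> real"
  assumes N: "\<And>a b c d. cross_ratio a b c d = 1 \<Longrightarrow> \<bar>Xbracket X a b c d\<bar> \<le> N"
    and X: "\<And>x. 0 \<le> X x"
    and ne: "a \<noteq> b" "b \<noteq> c" "a \<noteq> c" "2 * b \<noteq> a + c"
  shows "(c - a)\<^sup>2 * X b \<le> N * (\<bar>b - a\<bar> * \<bar>c - b\<bar> * \<bar>c - a\<bar>) + 2 * (c - b)\<^sup>2 * X a + 2 * (b - a)\<^sup>2 * X c"
proof -
  define u v where "u = b - a" and "v = c - b"
  have uv: "b = a + u" "c = a + u + v" by (simp_all add: u_def v_def)
  have nz: "u \<noteq> 0" "v \<noteq> 0" "u + v \<noteq> 0" "u \<noteq> v" using ne by (auto simp: u_def v_def)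
  obtain d where d: "cross_ratio a b c d = 1"
    "Xbracket X a b c d * (u * v * (u + v))
      = (u + v)\<^sup>2 * X b - 2 * v\<^sup>2 * X a - 2 * u\<^sup>2 * X c + (u - v)\<^sup>2 * X d"
    using Xbracket_harmonic[OF nz, of a X] unfolding uv by blast
  have "Xbracket X a b c d * (u * v * (u + v)) \<le> \<bar>Xbracket X a b c d\<bar> * \<bar>u * v * (u + v)\<bar>"
    by (metis abs_ge_self abs_mult)
  also have "\<dots> \<le> N * \<bar>u * v * (u + v)\<bar>"
    by (intro mult_right_mono N d) simp
  finally have "(u + v)\<^sup>2 * X b \<le> N * \<bar>u * v * (u + v)\<bar> + 2 * v\<^sup>2 * X a + 2 * u\<^sup>2 * X c"
    using d(2) X[of d] by (smt (verit) mult_nonneg_nonneg zero_le_power2)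
  then show ?thesis by (simp add: u_def v_def abs_mult)
qed

section \<open>The circle in Cayley coordinates\<close>

lemma cayley_Re_Im: "Re (cayley x) = (x\<^sup>2 - 1) / (x\<^sup>2 + 1)" "Im (cayley x) = - 2 * x / (x\<^sup>2 + 1)"
  by (simp_all add: cayley_def Re_divide Im_divide power2_eq_square)

lemma sq_plus_1_pos: "0 < x\<^sup>2 + (1::real)"
  by (simp add: add_nonneg_pos)

lemma cmod_cayley [simp]: "cmod (cayley x) = 1"
proof -
  have "(x\<^sup>2 - 1)\<^sup>2 + (2 * x)\<^sup>2 = (x\<^sup>2 + 1)\<^sup>2" by algebra
  then have "(cmod (cayley x))\<^sup>2 = 1"
    using sq_plus_1_pos[of x]
    by (simp add: cmod_power2 cayley_Re_Im power_divide add_divide_distrib[symmetric])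
  then show ?thesis by (simp add: power2_eq_1_iff) (smt (verit) norm_ge_zero)
qed

lemma cmod_cayley_diff:
  "cmod (cayley x - cayley y) = 2 * \<bar>x - y\<bar> / (sqrt (x\<^sup>2 + 1) * sqrt (y\<^sup>2 + 1))"
proof -
  have "cayley x - cayley y = 2 * \<i> * (x - y) / ((x + \<i>) * (y + \<i>))"
  proof -
    have "complex_of_real x + \<i> \<noteq> 0" "complex_of_real y + \<i> \<noteq> 0" by (auto simp: complex_eq_iff)
    then show ?thesis by (simp add: cayley_def divide_simps) (simp add: algebra_simps)
  qed
  moreover have "cmod (complex_of_real x + \<i>) = sqrt (x\<^sup>2 + 1)" for x by (simp add: cmod_def)
  moreover have "cmod (complex_of_real x - complex_of_real y) = \<bar>x - y\<bar>"
    by (metis norm_of_real of_real_diff)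
  ultimately show ?thesis by (simp add: norm_mult norm_divide)
qed

lemma cayley_surj:
  assumes "z \<in> sphere 0 1" "z \<noteq> 1"
  obtains x where "z = cayley x"
proof
  \<comment> \<open>Stereographic projection from 1, the point that corresponds to infinity.\<close>
  define p q x where "p = Re z" and "q = Im z" and "x = - q / (1 - p)"
  have pq: "p\<^sup>2 + q\<^sup>2 = 1" using assms(1) by (simp add: p_def q_def flip: cmod_power2)
  have p: "p \<noteq> 1" using assms(2) pq by (auto simp: p_def q_def complex_eq_iff)
  have x: "x\<^sup>2 = (1 + p) / (1 - p)"
  proof -
    have "q\<^sup>2 = (1 - p) * (1 + p)" using pq by algebra
    then show ?thesis using p by (simp add: x_def power_divide) (simp add: power2_eq_square)
  qed
  have "x\<^sup>2 + 1 = 2 / (1 - p)" "x\<^sup>2 - 1 = 2 * p / (1 - p)" using p by (simp_all add: x field_simps)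
  then have "Re (cayley x) = p" "Im (cayley x) = q"
    using p unfolding cayley_Re_Im by (simp_all add: x_def)
  then show "z = cayley x" by (simp add: p_def q_def complex_eq_iff)
qed

text \<open>The circle has no isolated points, so nonnegativity passes to the excluded points by
  continuity. This handles the positions where line coordinates degenerate.\<close>

lemma nonneg_on_circle_if_cofinite:
  fixes f :: "complex \<Rightarrow> real"
  assumes cont: "continuous_on (sphere 0 1) f" and "finite S"
    and nn: "\<And>z. z \<in> sphere 0 1 \<Longrightarrow> z \<notin> S \<Longrightarrow> 0 \<le> f z" and z: "z \<in> sphere 0 1"
  shows "0 \<le> f z"
proof (rule tendsto_lowerbound)
  show "(f \<longlongrightarrow> f z) (at z within sphere 0 1)"
    using cont z by (auto simp: continuous_on_def)
  have "open (- (S - {z}))" using assms(2) by (intro open_Compl finite_imp_closed finite_Diff)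
  then show "\<forall>\<^sub>F w in at z within sphere 0 1. 0 \<le> f w"
    unfolding eventually_at_topological using nn by (intro exI[of _ "- (S - {z})"]) auto
  have "connected (sphere (0::complex) 1)" by (simp add: connected_sphere)
  moreover have "sphere (0::complex) 1 \<noteq> {x}" for x
  proof
    assume eq: "sphere 0 1 = {x}"
    have "1 \<in> sphere (0::complex) 1" "- 1 \<in> sphere (0::complex) 1" by simp_all
    then have "x = 1" "x = - 1" unfolding eq by simp_all
    then show False by simp
  qed
  ultimately have "z islimpt sphere 0 1" using z by (intro connected_imp_perfect)
  then show "\<not> trivial_limit (at z within sphere 0 1)" by (simp add: trivial_limit_within)
qed

text \<open>The line inequality gives the case of general position; continuity extends it in w, then
  in z1, then in z2.\<close>

lemma three_point_ineq:
  fixes \<psi> :: "complex \<Rightarrow> real"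
  assumes cont: "continuous_on (sphere 0 1) \<psi>"
    and N: "\<And>a b c d. cross_ratio a b c d = 1 \<Longrightarrow> \<bar>Xbracket (Xline \<psi>) a b c d\<bar> \<le> N"
    and nonneg: "\<And>z. z \<in> sphere 0 1 \<Longrightarrow> 0 \<le> \<psi> z"
    and z: "z1 \<in> sphere 0 1" "w \<in> sphere 0 1" "z2 \<in> sphere 0 1"
  shows "(cmod (z2 - z1))\<^sup>2 * \<psi> w \<le> N * (cmod (w - z1) * cmod (z2 - w) * cmod (z2 - z1))
    + 2 * (cmod (z2 - w))\<^sup>2 * \<psi> z1 + 2 * (cmod (w - z1))\<^sup>2 * \<psi> z2"
proof -
  define F where "F z1 w z2 = N * (cmod (w - z1) * cmod (z2 - w) * cmod (z2 - z1))
    + 2 * (cmod (z2 - w))\<^sup>2 * \<psi> z1 + 2 * (cmod (w - z1))\<^sup>2 * \<psi> z2 - (cmod (z2 - z1))\<^sup>2 * \<psi> w"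
    for z1 w z2
  have cF: "continuous_on (sphere 0 1) (F z1 w)" "continuous_on (sphere 0 1) (\<lambda>w. F z1 w z2)"
    "continuous_on (sphere 0 1) (\<lambda>z1. F z1 w z2)" for z1 w z2
    unfolding F_def by (intro continuous_intros cont)+
  have generic: "0 \<le> F (cayley a) (cayley b) (cayley c)"
    if ne: "a \<noteq> b" "b \<noteq> c" "a \<noteq> c" "2 * b \<noteq> a + c" for a b c
  proof -
    define A B C where "A = sqrt (a\<^sup>2 + 1)" and "B = sqrt (b\<^sup>2 + 1)" and "C = sqrt (c\<^sup>2 + 1)"
    have pos: "A > 0" "B > 0" "C > 0"
      using sq_plus_1_pos by (auto simp: A_def B_def C_def)
    have sq: "A\<^sup>2 = a\<^sup>2 + 1" "B\<^sup>2 = b\<^sup>2 + 1" "C\<^sup>2 = c\<^sup>2 + 1"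
      using sq_plus_1_pos[of a] sq_plus_1_pos[of b] sq_plus_1_pos[of c]
      by (auto simp: A_def B_def C_def)
    have X: "0 \<le> Xline \<psi> x" for x
      unfolding Xline_def using sq_plus_1_pos[of x] nonneg[of "cayley x"] by simp
    have \<psi>: "\<psi> (cayley a) = 2 * Xline \<psi> a / A\<^sup>2" "\<psi> (cayley b) = 2 * Xline \<psi> b / B\<^sup>2"
      "\<psi> (cayley c) = 2 * Xline \<psi> c / C\<^sup>2"
      using pos by (auto simp: Xline_def simp flip: sq)
    \<comment> \<open>Three chords, or a squared chord times a value of \<open>\<psi>\<close>, both
      carry the factor 8 / (A^2 B^2 C^2).\<close>
    have "F (cayley a) (cayley b) (cayley c) = 8 / (A\<^sup>2 * B\<^sup>2 * C\<^sup>2) *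
      (N * (\<bar>b - a\<bar> * \<bar>c - b\<bar> * \<bar>c - a\<bar>) + 2 * (c - b)\<^sup>2 * Xline \<psi> a + 2 * (b - a)\<^sup>2 * Xline \<psi> c
        - (c - a)\<^sup>2 * Xline \<psi> b)"
      unfolding F_def cmod_cayley_diff \<psi> A_def[symmetric] B_def[symmetric] C_def[symmetric]
      using pos by (simp add: power_divide power_mult_distrib field_simps power2_eq_square)
    moreover have "0 \<le> N * (\<bar>b - a\<bar> * \<bar>c - b\<bar> * \<bar>c - a\<bar>) + 2 * (c - b)\<^sup>2 * Xline \<psi> a
        + 2 * (b - a)\<^sup>2 * Xline \<psi> c - (c - a)\<^sup>2 * Xline \<psi> b"
      using three_point_ineq_line[OF N X ne] by simp
    ultimately show ?thesis by simp
  qed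
  \<comment> \<open>Excluded are 1, which has no coordinate, coincidences with the outer points, and
    the midpoint, whose harmonic conjugate is infinite.\<close>
  have 1: "0 \<le> F (cayley a) w (cayley c)" if "w \<in> sphere 0 1" "a \<noteq> c" for a c w
  proof (rule nonneg_on_circle_if_cofinite[where z = w and f = "\<lambda>w. F (cayley a) w (cayley c)"
        and S = "{1, cayley a, cayley c, cayley ((a + c) / 2)}"])
    show "continuous_on (sphere 0 1) (\<lambda>w. F (cayley a) w (cayley c))" by (rule cF)
    fix w assume "w \<in> sphere 0 1" "w \<notin> {1, cayley a, cayley c, cayley ((a + c) / 2)}"
    moreover from this obtain b where b: "w = cayley b" using cayley_surj by blast
    ultimately have "a \<noteq> b" "b \<noteq> c" "b \<noteq> (a + c) / 2" by (metis insertCI)+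
    then show "0 \<le> F (cayley a) w (cayley c)"
      unfolding b using that(2) by (intro generic) auto
  qed (use that in auto)
  have 2: "0 \<le> F z1 w (cayley c)" if "z1 \<in> sphere 0 1" "w \<in> sphere 0 1" for z1 w c
  proof (rule nonneg_on_circle_if_cofinite[where z = z1 and f = "\<lambda>z. F z w (cayley c)"
        and S = "{1, cayley c}"])
    show "continuous_on (sphere 0 1) (\<lambda>z1. F z1 w (cayley c))" by (rule cF)
    fix z assume "z \<in> sphere 0 1" "z \<notin> {1, cayley c}"
    then show "0 \<le> F z w (cayley c)" using 1 that(2) cayley_surj by (metis insertCI)
  qed (use that in auto)
  have "0 \<le> F z1 w z2"
  proof (rule nonneg_on_circle_if_cofinite[where S = "{1}" and f = "F z1 w"])
    fix y assume "y \<in> sphere 0 1" "y \<notin> {1::complex}"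
    then show "0 \<le> F z1 w y" using 2 z cayley_surj by (metis insertCI)
  qed (use z cF in auto)
  then show ?thesis by (simp add: F_def)
qed

section \<open>Invariance of the bracket under affine functions, and contact points\<close>

lemma Xbracket_add:
  "Xbracket (\<lambda>x. X x + Y x) a b c d = Xbracket X a b c d + Xbracket Y a b c d"
  by (simp add: Xbracket_def add_divide_distrib diff_divide_distrib)

text \<open>Since x / 0 = 0, coinciding cyclic neighbours would make the cross-ratio 0.\<close>

lemma cross_ratio_1_distinct:
  assumes "cross_ratio a b c d = 1"
  shows "a \<noteq> b" "b \<noteq> c" "c \<noteq> d" "d \<noteq> a"
  using assms by (auto simp: cross_ratio_def)

text \<open>Affine functions are the support functions of Killing fields, which become quadratic on the line.\<close>
lemma Xbracket_mpair:
  assumes "cross_ratio a b c d = 1"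
  shows "Xbracket (Xline (\<lambda>z. mpair z \<sigma>)) a b c d = 0"
proof -
  define \<alpha> \<beta> \<gamma> where "\<alpha> = (fst (snd \<sigma>) - fst \<sigma>) / 2" and "\<beta> = - snd (snd \<sigma>)"
    and "\<gamma> = (- fst \<sigma> - fst (snd \<sigma>)) / 2"
  have X: "Xline (\<lambda>z. mpair z \<sigma>) x = \<alpha> * x\<^sup>2 + \<beta> * x + \<gamma>" for x
  proof -
    have "(x\<^sup>2 + 1) * Re (cayley x) = x\<^sup>2 - 1" "(x\<^sup>2 + 1) * Im (cayley x) = - 2 * x"
      using sq_plus_1_pos[of x] by (simp_all add: cayley_Re_Im)
    moreover have "Xline (\<lambda>z. mpair z \<sigma>) x = - (x\<^sup>2 + 1) / 2 * fst \<sigma>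
        + (x\<^sup>2 + 1) * Re (cayley x) * fst (snd \<sigma>) / 2 + (x\<^sup>2 + 1) * Im (cayley x) * snd (snd \<sigma>) / 2"
      by (simp add: Xline_def mpair_def field_simps)
    ultimately have "Xline (\<lambda>z. mpair z \<sigma>) x = - (x\<^sup>2 + 1) / 2 * fst \<sigma>
        + (x\<^sup>2 - 1) * fst (snd \<sigma>) / 2 + (- 2 * x) * snd (snd \<sigma>) / 2"
      by (simp only:)
    then show ?thesis
      by (simp add: \<alpha>_def \<beta>_def \<gamma>_def field_simps)
  qed
  have quot: "(Xline (\<lambda>z. mpair z \<sigma>) x - Xline (\<lambda>z. mpair z \<sigma>) y) / (x - y) = \<alpha> * (x + y) + \<beta>"
    if "x \<noteq> y" for x y
    using that unfolding X by (simp add: divide_eq_eq) (simp add: power2_eq_square algebra_simps)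
  \<comment> \<open>\<open>\<beta>\<close> cancels and \<open>\<alpha>\<close> multiplies (a + b) -
    (b + c) + (c + d) - (d + a) = 0.\<close>
  show ?thesis
    unfolding Xbracket_def using cross_ratio_1_distinct[OF assms]
    by (simp add: quot) (simp add: algebra_simps)
qed

text \<open>Otherwise the plane could be tilted and raised at \<open>\<eta>\<close>.\<close>
lemma contact_point_in_half_plane:
  assumes cont: "continuous_on (sphere 0 1) \<phi>" and \<sigma>: "\<sigma> \<in> minorants \<phi>"
    and max: "\<And>\<tau>. \<tau> \<in> minorants \<phi> \<Longrightarrow> mpair \<eta> \<tau> \<le> mpair \<eta> \<sigma>"
    and \<rho>: "mpair \<eta> \<rho> = 0"
  obtains z where "z \<in> sphere 0 1" "\<phi> z = mpair z \<sigma>" "0 \<le> mpair z \<rho>"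
proof (rule ccontr)
  assume "\<not> thesis"
  with that have neg: "mpair z \<rho> < 0" if "z \<in> sphere 0 1" "\<phi> z = mpair z \<sigma>" for z
    using that by (meson not_le)
  define g where "g z = \<phi> z - mpair z \<sigma>" for z
  have cg: "continuous_on (sphere 0 1) g"
    unfolding g_def by (intro continuous_intros cont continuous_on_mpair)
  have g: "0 \<le> g z" if "z \<in> sphere 0 1" for z using \<sigma> that by (simp add: g_def minorants_def)
  \<comment> \<open>Where the gap \<open>g\<close> vanishes, \<open>\<rho>\<close> is negative;
    compactness makes this alternative uniform.\<close>
  have "\<exists>c>0. \<forall>z\<in>sphere 0 1. c \<le> max (g z) (- mpair z \<rho>)"
  proof -
    have "continuous_on (sphere 0 1) (\<lambda>z. max (g z) (- mpair z \<rho>))"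
      by (intro continuous_intros cg continuous_on_mpair)
    moreover have "sphere (0::complex) 1 \<noteq> {}" by simp
    ultimately obtain x where x: "x \<in> sphere 0 1"
      "\<And>z. z \<in> sphere 0 1 \<Longrightarrow> max (g x) (- mpair x \<rho>) \<le> max (g z) (- mpair z \<rho>)"
      using continuous_attains_inf[OF compact_sphere] by blast
    moreover have "0 < max (g x) (- mpair x \<rho>)"
      using neg[OF x(1)] g[OF x(1)] by (cases "g x = 0") (auto simp: g_def)
    ultimately show ?thesis by blast
  qed
  then obtain c where c: "c > 0" "\<forall>z\<in>sphere 0 1. c \<le> max (g z) (- mpair z \<rho>)"
    by blast
  have "bounded ((\<lambda>z. mpair z \<rho>) ` sphere 0 1)"
    by (intro compact_imp_bounded compact_continuous_image continuous_on_mpair compact_sphere)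
  then obtain M where M: "\<And>z. z \<in> sphere 0 1 \<Longrightarrow> \<bar>mpair z \<rho>\<bar> \<le> M"
    unfolding bounded_iff by (metis imageI real_norm_def)
  have M0: "0 \<le> M" using M[of 1] by simp
  \<comment> \<open>The tilted plane rises by e (\<rho> + c). This is at most c, hence harmless
    where the gap is at least c; elsewhere \<rho> \<le> -c and the plane does not rise. At
    \<open>\<eta>\<close> it gains e c > 0.\<close>
  define e where "e = c / (M + c)"
  have e: "e > 0" "e * (M + c) = c" using c(1) M0 by (auto simp: e_def)
  define \<tau> where "\<tau> = \<sigma> + e *\<^sub>R (\<rho> + (- c, 0, 0))"
  have \<tau>: "mpair z \<tau> = mpair z \<sigma> + e * (mpair z \<rho> + c)" for z
    unfolding \<tau>_def mpair_linear by (simp add: mpair_def)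
  have "\<tau> \<in> minorants \<phi>"
    unfolding minorants_def
  proof (clarify)
    fix z :: complex assume z: "z \<in> sphere 0 1"
    have "c \<le> g z \<or> mpair z \<rho> \<le> - c"
      using bspec[OF c(2) z] by (simp only: le_max_iff_disj) linarith
    then have "e * (mpair z \<rho> + c) \<le> g z"
    proof
      assume "c \<le> g z"
      moreover have "e * (mpair z \<rho> + c) \<le> e * (M + c)"
        using e(1) M[OF z] by (intro mult_left_mono) auto
      ultimately show ?thesis using e(2) by simp
    next
      assume "mpair z \<rho> \<le> - c"
      then have "e * (mpair z \<rho> + c) \<le> 0" using e(1) by (simp add: mult_nonneg_nonpos)
      then show ?thesis using g[OF z] by simp
    qed
    then show "mpair z \<tau> \<le> \<phi> z" by (simp add: \<tau> g_def)
  qed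
  from max[OF this] show False using e(1) c(1) by (simp add: \<tau> \<rho> mult_le_0_iff)
qed

section \<open>Chords seen from an interior point, and the width estimate\<close>

lemma mpair_of_inner:
  obtains \<rho> where "\<And>z. mpair z \<rho> = s * (1 - z \<bullet> x) - t * (1 - z \<bullet> y)"
proof
  show "mpair z (t - s, t * Re y - s * Re x, t * Im y - s * Im x) = s * (1 - z \<bullet> x) - t * (1 - z \<bullet> y)" for z
    by (simp add: mpair_def inner_complex_def algebra_simps)
qed

lemma chord_sq:
  assumes "z \<in> sphere 0 1" "w \<in> sphere 0 1"
  shows "(cmod (z - w))\<^sup>2 = 2 * (1 - z \<bullet> w)"
proof -
  have "z \<bullet> z = 1" "w \<bullet> w = 1" using assms by (simp_all flip: power2_norm_eq_inner)
  then show ?thesis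
    unfolding power2_norm_eq_inner by (simp add: inner_diff inner_commute)
qed

lemma one_minus_inner_pos:
  fixes z \<eta> :: complex
  assumes "z \<in> sphere 0 1" "\<eta> \<in> ball 0 1"
  shows "0 < 1 - z \<bullet> \<eta>"
  using norm_cauchy_schwarz[of z \<eta>] assms by simp

text \<open>In the frame where \<open>\<eta>\<close> is the centre of the disk this says that chords have length at most 2.\<close>
lemma chord_le_diameter:
  fixes z w \<eta> :: complex
  assumes "z \<in> sphere 0 1" "w \<in> sphere 0 1"
  shows "(1 - z \<bullet> w) * (1 - (cmod \<eta>)\<^sup>2) \<le> 2 * (1 - w \<bullet> \<eta>) * (1 - z \<bullet> \<eta>)"
proof -
  \<comment> \<open>The claim rearranges to z \<bullet> v \<le> |w - \<eta>|^2, and the right-hand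
    side is exactly the norm of \<open>v\<close>.\<close>
  define v where "v = (2 * (1 - w \<bullet> \<eta>)) *\<^sub>R \<eta> - (1 - (cmod \<eta>)\<^sup>2) *\<^sub>R w"
  have w: "w \<bullet> w = 1" using assms(2) by (simp flip: power2_norm_eq_inner)
  have "(norm v)\<^sup>2 = (1 - 2 * (w \<bullet> \<eta>) + (cmod \<eta>)\<^sup>2)\<^sup>2"
    unfolding power2_norm_eq_inner v_def
    by (simp add: inner_diff inner_commute w) (simp add: power2_eq_square algebra_simps)
  moreover have "0 \<le> 1 - 2 * (w \<bullet> \<eta>) + (cmod \<eta>)\<^sup>2"
    using w inner_ge_zero[of "w - \<eta>"] by (simp add: inner_diff inner_commute power2_norm_eq_inner)
  ultimately have "norm v = 1 - 2 * (w \<bullet> \<eta>) + (cmod \<eta>)\<^sup>2" by (simp add: power2_eq_iff_nonneg)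
  moreover have "z \<bullet> v \<le> norm v" using norm_cauchy_schwarz[of z v] assms(1) by simp
  ultimately show ?thesis
    by (simp add: v_def inner_diff inner_commute algebra_simps)
qed

text \<open>In the frame centred at \<open>\<eta>\<close>, a squared chord becomes c^2 H divided by
  the factors \<open>W\<close>, \<open>a1\<close> or \<open>a2\<close> of its ends. There c1 \<le>
  sqrt 2, c2 \<le> 2 and c12 \<ge> sqrt 2, so c1 c2 / c12 \<le> 2.\<close>

lemma support_gap_le:
  assumes cont: "continuous_on (sphere 0 1) \<phi>" and \<eta>: "\<eta> \<in> ball 0 1"
    and N: "\<And>a b c d. cross_ratio a b c d = 1 \<Longrightarrow> \<bar>Xbracket (Xline \<phi>) a b c d\<bar> \<le> N"
    and \<sigma>: "\<sigma> \<in> minorants \<phi>" and max: "\<And>\<tau>. \<tau> \<in> minorants \<phi> \<Longrightarrow> mpair \<eta> \<tau> \<le> mpair \<eta> \<sigma>"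
    and w: "w \<in> sphere 0 1" and "N \<ge> 0"
  shows "(\<phi> w - mpair w \<sigma>) * sqrt (1 - (cmod \<eta>)\<^sup>2) \<le> 2 * N * (1 - w \<bullet> \<eta>)"
proof -
  define H where "H = 1 - (cmod \<eta>)\<^sup>2"
  have H: "H > 0" using \<eta> by (simp add: H_def power_less_one_iff)
  have H': "1 - \<eta> \<bullet> \<eta> = H" by (simp add: H_def power2_norm_eq_inner)
  define \<psi> where "\<psi> z = \<phi> z - mpair z \<sigma>" for z
  \<comment> \<open>In the centred frame this half-plane consists of the directions within 90
    degrees of w.\<close>
  obtain \<rho>1 where \<rho>1: "\<And>z. mpair z \<rho>1 = (1 - w \<bullet> \<eta>) * (1 - z \<bullet> \<eta>) - H * (1 - z \<bullet> w)"
    using mpair_of_inner by blast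
  have "mpair \<eta> \<rho>1 = 0" by (simp add: \<rho>1 H' inner_commute)
  then obtain z1 where z1: "z1 \<in> sphere 0 1" "\<phi> z1 = mpair z1 \<sigma>" "0 \<le> mpair z1 \<rho>1"
    using contact_point_in_half_plane[OF cont \<sigma> max] by blast
  \<comment> \<open>The opposite kind of half-plane: directions at least 90 degrees away from
    z1.\<close>
  obtain \<rho>2 where \<rho>2: "\<And>z. mpair z \<rho>2 = H * (1 - z \<bullet> z1) - (1 - z1 \<bullet> \<eta>) * (1 - z \<bullet> \<eta>)"
    using mpair_of_inner by blast
  have "mpair \<eta> \<rho>2 = 0" by (simp add: \<rho>2 H' inner_commute)
  then obtain z2 where z2: "z2 \<in> sphere 0 1" "\<phi> z2 = mpair z2 \<sigma>" "0 \<le> mpair z2 \<rho>2"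
    using contact_point_in_half_plane[OF cont \<sigma> max] by blast
  define W a1 a2 where "W = 1 - w \<bullet> \<eta>" and "a1 = 1 - z1 \<bullet> \<eta>" and "a2 = 1 - z2 \<bullet> \<eta>"
  have pos: "W > 0" "a1 > 0" "a2 > 0"
    unfolding W_def a1_def a2_def by (intro one_minus_inner_pos w z1(1) z2(1) \<eta>)+
  define c1 c2 c12 where "c1 = cmod (w - z1)" and "c2 = cmod (z2 - w)" and "c12 = cmod (z2 - z1)"
  have chords: "c1\<^sup>2 = 2 * (1 - z1 \<bullet> w)" "c2\<^sup>2 = 2 * (1 - z2 \<bullet> w)" "c12\<^sup>2 = 2 * (1 - z2 \<bullet> z1)"
    using chord_sq[OF w z1(1)] chord_sq[OF z2(1) w] chord_sq[OF z2(1) z1(1)]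
    by (simp_all add: c1_def c2_def c12_def inner_commute)
  have c1: "c1\<^sup>2 * H \<le> 2 * (W * a1)"
    using z1(3) unfolding chords \<rho>1 W_def a1_def by (simp add: algebra_simps)
  have c2: "c2\<^sup>2 * H \<le> 4 * (W * a2)"
    using chord_le_diameter[OF z2(1) w, of \<eta>] unfolding chords W_def a2_def H_def by (simp add: algebra_simps)
  have c12: "2 * (a1 * a2) \<le> c12\<^sup>2 * H"
    using z2(3) unfolding chords \<rho>2 a1_def a2_def by (simp add: algebra_simps)
  have c12_pos: "0 < c12"
  proof -
    have "0 < c12\<^sup>2 * H" using c12 pos by (intro less_le_trans[OF _ c12]) simp
    then have "c12 \<noteq> 0" by auto
    then show ?thesis by (simp add: c12_def)
  qed
  have key: "c1 * c2 * sqrt H \<le> 2 * W * c12"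
  proof (rule power2_le_imp_le)
    have "(c1\<^sup>2 * H) * (c2\<^sup>2 * H) \<le> (2 * (W * a1)) * (4 * (W * a2))"
      using c1 c2 H pos by (intro mult_mono[OF c1 c2]) auto
    also have "\<dots> = (4 * W\<^sup>2) * (2 * (a1 * a2))" by (simp add: power2_eq_square)
    also have "\<dots> \<le> (4 * W\<^sup>2) * (c12\<^sup>2 * H)" using c12 by (intro mult_left_mono) auto
    finally have "(c1\<^sup>2 * c2\<^sup>2 * H) * H \<le> (4 * W\<^sup>2 * c12\<^sup>2) * H" by (simp add: mult_ac)
    then show "(c1 * c2 * sqrt H)\<^sup>2 \<le> (2 * W * c12)\<^sup>2"
      using H by (simp add: power_mult_distrib)
    show "0 \<le> 2 * W * c12" using pos c12_pos by simp
  qed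
  have "c12\<^sup>2 * \<psi> w \<le> N * (c1 * c2 * c12)"
  proof -
    have "continuous_on (sphere 0 1) \<psi>"
      unfolding \<psi>_def by (intro continuous_intros cont continuous_on_mpair)
    moreover have "\<bar>Xbracket (Xline \<psi>) a b c d\<bar> \<le> N" if cr: "cross_ratio a b c d = 1" for a b c d
    proof -
      have "Xline \<phi> = (\<lambda>x. Xline \<psi> x + Xline (\<lambda>z. mpair z \<sigma>) x)"
        by (simp add: Xline_def \<psi>_def fun_eq_iff field_simps)
      then have "Xbracket (Xline \<phi>) a b c d = Xbracket (Xline \<psi>) a b c d"
        by (simp add: Xbracket_add Xbracket_mpair[OF cr])
      then show ?thesis using N[OF cr] by simp
    qed
    moreover have "0 \<le> \<psi> z" if "z \<in> sphere 0 1" for z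
      using \<sigma> that by (simp add: \<psi>_def minorants_def)
    ultimately have "c12\<^sup>2 * \<psi> w \<le> N * (c1 * c2 * c12) + 2 * c2\<^sup>2 * \<psi> z1 + 2 * c1\<^sup>2 * \<psi> z2"
      unfolding c1_def c2_def c12_def by (intro three_point_ineq z1(1) z2(1) w) auto
    then show ?thesis by (simp add: \<psi>_def z1(2) z2(2))
  qed
  then have "c12 * (c12 * \<psi> w) \<le> c12 * (N * (c1 * c2))" by (simp add: power2_eq_square mult_ac)
  then have "c12 * \<psi> w \<le> N * (c1 * c2)" using c12_pos by simp
  then have "c12 * \<psi> w * sqrt H \<le> N * (c1 * c2) * sqrt H" using H by (intro mult_right_mono) auto
  also have "\<dots> = N * (c1 * c2 * sqrt H)" by simp
  also have "\<dots> \<le> N * (2 * W * c12)" using key assms(7) by (rule mult_left_mono)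
  finally have "c12 * (\<psi> w * sqrt H) \<le> c12 * (2 * N * W)" by (simp add: mult_ac)
  then have "\<psi> w * sqrt H \<le> 2 * N * W" using c12_pos by simp
  then show ?thesis by (simp add: \<psi>_def H_def W_def)
qed

lemma width_quotient_le:
  assumes cont: "continuous_on (sphere 0 1) \<phi>" and \<eta>: "\<eta> \<in> ball 0 1"
    and N: "\<And>a b c d. cross_ratio a b c d = 1 \<Longrightarrow> \<bar>Xbracket (Xline \<phi>) a b c d\<bar> \<le> N" and "N \<ge> 0"
  shows "(phi_upper \<phi> \<eta> - phi_lower \<phi> \<eta>) / sqrt (1 - (cmod \<eta>)\<^sup>2) \<le> 2 * N"
proof -
  define H where "H = 1 - (cmod \<eta>)\<^sup>2"
  have H: "H > 0" using \<eta> by (simp add: H_def power_less_one_iff)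
  obtain \<sigma> where \<sigma>: "\<sigma> \<in> minorants \<phi>" "\<And>\<tau>. \<tau> \<in> minorants \<phi> \<Longrightarrow> mpair \<eta> \<tau> \<le> mpair \<eta> \<sigma>"
    using extremal_minorant_exists[OF cont \<eta>] by blast
  \<comment> \<open>The affine function bounding the gap on the circle; its value at
    \<open>\<eta>\<close> is 2 N sqrt H because 1 - \<eta> \<bullet> \<eta> = H.\<close>
  obtain \<rho> where \<rho>: "\<And>z. mpair z \<rho> = (2 * N / sqrt H) * (1 - z \<bullet> \<eta>) - 0 * (1 - z \<bullet> \<eta>)"
    using mpair_of_inner by blast
  have "phi_upper \<phi> \<eta> \<le> mpair \<eta> (\<sigma> + \<rho>)"
  proof (rule phi_upper_le[OF cont \<eta>])
    fix w :: complex assume "w \<in> sphere 0 1"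
    then have "(\<phi> w - mpair w \<sigma>) * sqrt H \<le> 2 * N * (1 - w \<bullet> \<eta>)"
      unfolding H_def by (intro support_gap_le assms \<sigma>)
    then show "\<phi> w \<le> mpair w (\<sigma> + \<rho>)"
      using H by (simp add: mpair_add \<rho> field_simps)
  qed
  also have "\<dots> = phi_lower \<phi> \<eta> + 2 * N / sqrt H * H"
    using phi_lower_attained[OF \<sigma>] by (simp add: mpair_add \<rho> H_def power2_norm_eq_inner)
  also have "2 * N / sqrt H * H = 2 * N * sqrt H"
    using H by (simp add: real_div_sqrt field_simps)
  finally show ?thesis using H by (simp add: divide_le_eq flip: H_def)
qed

lemma width_le_cr_norm:
  assumes "continuous_on (sphere 0 1) \<phi>"
  shows "width \<phi> \<le> ereal (8 / 3) * cr_norm \<phi>"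
proof -
  have bracket: "ereal \<bar>Xbracket (Xline \<phi>) a b c d\<bar> \<le> cr_norm \<phi>" if "cross_ratio a b c d = 1" for a b c d
    unfolding cr_norm_def using that by (intro Sup_upper) blast
  \<comment> \<open>One admissible quadruple shows that the supremum is over a nonempty set, hence
    nonnegative.\<close>
  have "cross_ratio 0 2 3 6 = 1" by (simp add: cross_ratio_def)
  from bracket[OF this] have nonneg: "0 \<le> cr_norm \<phi>"
    by (meson abs_ge_zero ereal_less_eq(5) order_trans)
  show ?thesis
  proof (cases "cr_norm \<phi>")
    case (real N)
    have "width \<phi> \<le> ereal (2 * N)"
      unfolding width_def
    proof (rule Sup_least, clarify)
      fix \<eta> :: complex assume "\<eta> \<in> ball 0 1"
      then show "ereal ((phi_upper \<phi> \<eta> - phi_lower \<phi> \<eta>) / sqrt (1 - (cmod \<eta>)\<^sup>2)) \<le> ereal (2 * N)"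
        using bracket nonneg real by (simp only: ereal_less_eq) (intro width_quotient_le assms, auto)
    qed
    also have "\<dots> \<le> ereal (8 / 3) * cr_norm \<phi>" using nonneg real by simp
    finally show ?thesis .
  qed (use nonneg in auto)
qed

theorem theorem1p3:
  fixes phi :: "complex \<Rightarrow> real"
  assumes "continuous_on (sphere 0 1) phi"
  shows "ereal ((1 - tanh 1) / (2 * sqrt 2)) * thurston_norm (Sigma_lower phi) (phi_lower phi) \<le> width phi
       \<and> ereal ((1 - tanh 1) / (2 * sqrt 2)) * thurston_norm (Sigma_upper phi) (phi_upper phi) \<le> width phi
       \<and> width phi \<le> ereal (8 / 3) * cr_norm phi"
  using thurston_lower_le_width[OF assms] thurston_upper_le_width[OF assms] width_le_cr_norm[OF assms]
  by blast

end
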